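(* Let $G$ be a finite simple graph with at least one vertex, with projective rank $\xi_f(G)$ and inertia $(n^+,n^0,n^-)$. Then \[ 1 + \max\left( \frac{n^+}{n^- + n^0}, \frac{n^-}{n^+ + n^0} \right) \le \xi_f(G). \]
   Context: For a finite simple undirected graph $G=(V,E)$ with adjacency matrix $A$, the inertia of $G$ is the ordered triple $(n^+,n^0,n^-)$, where $n^+$, $n^0$, $n^-$ are the numbers of positive, zero and negative eigenvalues of $A$, counted with multiplicity. For positive integers $d,r$, a $d/r$-representation of $G$ is a collection of rank-$r$ orthogonal projectors $P_v\in\mathbb{C}^{d\times d}$, $v\in V$, such that $P_vP_w=0_d$ for all $vw\in E$. The $r$-fold orthogonal rank is \[ \xi^{[r]}(G)=\min\{d : G \text{ has a } d/r\text{-representation}\}, \] and the projective rank is \[ \xi_f(G)=\lim_{r\to\infty}\frac{\xi^{[r]}(G)}{r}, \] where it is known that this limit exists. *)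

theory Defs
  imports
    "Graph_Theory.Pair_Digraph"
    "Jordan_Normal_Form.Char_Poly"
    "Jordan_Normal_Form.Schur_Decomposition"
    "Jordan_Normal_Form.DL_Rank"
    Complex_Main
begin

text \<open>
  Finite simple undirected graphs are the library's \<open>pair_graph\<close>s: a finite vertex set with an
  irreflexive symmetric set of ordered pairs, each undirected edge \<open>vw\<close> being represented by both
  \<open>(v, w)\<close> and \<open>(w, v)\<close>.

  Rows and columns of the adjacency matrix are indexed by positions in a list \<open>vs\<close>, meant to
  enumerate the vertices without repetition.
\<close>

definition adjacency_matrix :: "'v pair_pre_digraph \<Rightarrow> 'v list \<Rightarrow> real mat" where
  "adjacency_matrix G vs =
     mat (length vs) (length vs) (\<lambda>(i, j). if (vs ! i, vs ! j) \<in> parcs G then 1 else 0)"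

definition count_eigenvalues :: "(real \<Rightarrow> bool) \<Rightarrow> real mat \<Rightarrow> nat" where
  "count_eigenvalues Q A = (\<Sum>k | eigenvalue A k \<and> Q k. Polynomial.order k (char_poly A))"

text \<open>The triple is ordered as (positive, zero, negative).\<close>

definition inertia :: "real mat \<Rightarrow> nat \<times> nat \<times> nat" where
  "inertia A =
     (count_eigenvalues (\<lambda>k. k > 0) A,
      count_eigenvalues (\<lambda>k. k = 0) A,
      count_eigenvalues (\<lambda>k. k < 0) A)"

definition orthogonal_projector :: "nat \<Rightarrow> complex mat \<Rightarrow> bool" where
  "orthogonal_projector d P \<longleftrightarrow> P \<in> carrier_mat d d \<and> P * P = P \<and> mat_adjoint P = P"

definition is_representation ::
    "'v pair_pre_digraph \<Rightarrow> nat \<Rightarrow> nat \<Rightarrow> ('v \<Rightarrow> complex mat) \<Rightarrow> bool" where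
  "is_representation G d r P \<longleftrightarrow>
     (\<forall>v \<in> pverts G. orthogonal_projector d (P v) \<and> vec_space.rank d (P v) = r) \<and>
     (\<forall>(v, w) \<in> parcs G. P v * P w = 0\<^sub>m d d)"

text \<open>
  For a finite graph and \<open>r > 0\<close> the set of admissible \<open>d\<close> is nonempty, so \<open>LEAST\<close> is a minimum.
  The value at \<open>r = 0\<close> is irrelevant.
\<close>

definition orthogonal_rank :: "nat \<Rightarrow> 'v pair_pre_digraph \<Rightarrow> nat" where
  "orthogonal_rank r G = (LEAST d. 0 < d \<and> (\<exists>P. is_representation G d r P))"

definition projective_rank :: "'v pair_pre_digraph \<Rightarrow> real" where
  "projective_rank G = lim (\<lambda>r. real (orthogonal_rank r G) / real r)"

end

theory Submission
  imports Defs
begin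

text \<open>
  Let \<open>A\<close> be the adjacency matrix of a graph on \<open>n\<close> vertices and take a \<open>d/r\<close>-representation by
  projectors \<open>P\<^sub>v\<close>. Vectors \<open>x = (x\<^sub>v)\<close> with \<open>x\<^sub>v\<close> in the range of \<open>P\<^sub>v\<close> form a subspace of dimension
  \<open>r n\<close> of \<open>\<complex>\<^sup>n \<otimes> \<complex>\<^sup>d\<close>. On this subspace the Hermitian form of \<open>A \<otimes> I\<^sub>d\<close> vanishes identically, because
  adjacent vertices have orthogonal ranges. The form is positive definite on a subspace of dimension
  \<open>d n\<^sup>+\<close>, which therefore meets the isotropic subspace only in \<open>0\<close>; counting dimensions,
  \<open>r n + d n\<^sup>+ \<le> d n\<close>. Since \<open>n = n\<^sup>+ + n\<^sup>0 + n\<^sup>-\<close>, this says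
  \<open>d / r \<ge> n / (n\<^sup>- + n\<^sup>0) = 1 + n\<^sup>+ / (n\<^sup>- + n\<^sup>0)\<close>. Negative eigenvalues are treated in the same way.

  The argument is carried out in coordinates. The spectral theorem
  (\<open>hermitian_unitarily_diagonalizable\<close>) gives \<open>A = U D U\<^sup>*\<close> with \<open>D\<close> real diagonal, and
  \<open>char_poly_real_diagonalized\<close> identifies the inertia with the signs on the diagonal of \<open>D\<close>.
  A representing projector factors as \<open>P\<^sub>v = X\<^sub>v Z\<^sub>v\<close> with \<open>Z\<^sub>v X\<^sub>v = 1\<close>
  (\<open>idempotent_factorization\<close>), so the isotropic subspace has \<open>r n\<close> free coordinates. In
  \<open>isotropic_dimension_bound\<close> the dimension count becomes the solvability of an underdetermined
  homogeneous linear system.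

  The bound holds for every \<open>d\<close> and \<open>r\<close>, and it remains to pass to the limit. Direct sums of
  representations make \<open>r \<mapsto> \<xi>\<^sup>[\<^sup>r\<^sup>]\<close> subadditive, so Fekete's argument shows that the limit defining the
  projective rank exists (\<open>projective_rank_limit\<close>). The rank of a direct sum of projectors is
  read off from the trace, which equals the rank for an idempotent matrix.
\<close>

section \<open>Spectral theorem for Hermitian matrices\<close>

lemma mat_adjoint_carrier: "A \<in> carrier_mat m n \<Longrightarrow> mat_adjoint A \<in> carrier_mat n m"
  by (auto simp: mat_adjoint_def mat_of_rows_def)

lemma mat_adjoint_dim [simp]:
  "dim_row (mat_adjoint A) = dim_col A" "dim_col (mat_adjoint A) = dim_row A"
  by (auto simp: mat_adjoint_def)

lemma mat_adjoint_index [simp]: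
  assumes "i < dim_col A" "j < dim_row A"
  shows "mat_adjoint A $$ (i, j) = conjugate (A $$ (j, i))"
  using assms by (auto simp: mat_adjoint_def mat_of_rows_def)

lemma mat_adjoint_involution: "mat_adjoint (mat_adjoint A) = (A :: 'a::conjugatable_field mat)"
  by (rule eq_matI) auto

lemma mat_adjoint_mult:
  fixes A B :: "complex mat"
  assumes "A \<in> carrier_mat m n" "B \<in> carrier_mat n k"
  shows "mat_adjoint (A * B) = mat_adjoint B * mat_adjoint A"
proof (rule eq_matI)
  fix i j assume ij: "i < dim_row (mat_adjoint B * mat_adjoint A)"
    "j < dim_col (mat_adjoint B * mat_adjoint A)"
  then have ij': "i < k" "j < m" using assms by auto
  show "mat_adjoint (A * B) $$ (i, j) = (mat_adjoint B * mat_adjoint A) $$ (i, j)"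
    using assms ij'
    by (auto simp: scalar_prod_def sum_conjugate conjugate_dist_mul intro!: sum.cong mult.commute)
qed (use assms in auto)

lemma mat_adjoint_four_block:
  assumes "A \<in> carrier_mat r1 c1" "B \<in> carrier_mat r1 c2" "C \<in> carrier_mat r2 c1" "D \<in> carrier_mat r2 c2"
  shows "mat_adjoint (four_block_mat A B C D)
    = four_block_mat (mat_adjoint A) (mat_adjoint C) (mat_adjoint B) (mat_adjoint D)"
  using assms by (intro eq_matI) auto

text \<open>
  Complete \<open>v\<close> to a basis, orthogonalize and normalize. Normalization matters: conjugation by the
  inverse of a matrix with merely orthogonal columns need not preserve Hermitian matrices.
\<close>

lemma unitary_completion:
  fixes v :: "complex vec"
  assumes v: "v \<in> carrier_vec n" "v \<noteq> 0\<^sub>v n"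
  shows "\<exists>W c. W \<in> carrier_mat n n \<and> mat_adjoint W * W = 1\<^sub>m n \<and> col W 0 = c \<cdot>\<^sub>v v"
proof -
  interpret cof_vec_space n "TYPE(complex)" .
  define b where "b = basis_completion v"
  define ws where "ws = gram_schmidt n b"
  note bc = basis_completion[OF v, folded b_def]
  have n: "n \<noteq> 0" using v by (metis carrier_vecD dim_vec eq_vecI index_zero_vec(2) not_less_zero)
  obtain vs where bv: "b = v # vs" using bc n by (cases b) auto
  have ws: "set ws \<subseteq> carrier_vec n" "corthogonal ws" "length ws = n"
    using gram_schmidt_result[of b ws] bc ws_def by auto
  have hd: "ws ! 0 = v"
    using gram_schmidt_hd[OF v(1), of vs] ws(3) n unfolding ws_def bv
    by (metis hd_conv_nth list.size(3))
  define s where "s i = Re (ws ! i \<bullet>c ws ! i)" for i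
  have nrm: "ws ! i \<bullet>c ws ! i = of_real (s i) \<and> s i > 0" if "i < n" for i
  proof -
    have c: "ws ! i \<in> carrier_vec n" using ws that by auto
    have "ws ! i \<bullet>c ws ! i \<ge> 0" by (rule conjugate_square_ge_0_vec)
    moreover have "ws ! i \<bullet>c ws ! i \<noteq> 0" using ws that unfolding corthogonal_def by auto
    ultimately show ?thesis unfolding s_def by (auto simp: less_eq_complex_def complex_eq_iff)
  qed
  define W where "W = mat n n (\<lambda>(i, j). ws ! j $ i / of_real (sqrt (s j)))"
  have W: "W \<in> carrier_mat n n" by (simp add: W_def)
  have "mat_adjoint W * W = 1\<^sub>m n"
  proof (rule eq_matI)
    fix i j assume "i < dim_row (1\<^sub>m n :: complex mat)" "j < dim_col (1\<^sub>m n :: complex mat)"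
    then have ij: "i < n" "j < n" by auto
    have d: "dim_vec (ws ! i) = n" "dim_vec (ws ! j) = n"
      using ij ws(3) carrier_vecD[OF subsetD[OF ws(1) nth_mem]] by auto
    have "(mat_adjoint W * W) $$ (i, j) =
      (\<Sum>a<n. cnj (ws ! i $ a) / of_real (sqrt (s i)) * (ws ! j $ a / of_real (sqrt (s j))))"
      using ij W by (auto simp: scalar_prod_def W_def atLeast0LessThan intro!: sum.cong)
    also have "\<dots> = (\<Sum>a<n. ws ! j $ a * cnj (ws ! i $ a)) / (of_real (sqrt (s i)) * of_real (sqrt (s j)))"
      unfolding sum_divide_distrib by (intro sum.cong) (auto simp: field_simps)
    also have "(\<Sum>a<n. ws ! j $ a * cnj (ws ! i $ a)) = ws ! j \<bullet>c ws ! i"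
      using d by (auto simp: scalar_prod_def atLeast0LessThan)
    also have "\<dots> = (if i = j then of_real (s i) else 0)"
      using nrm[of i] ij ws unfolding corthogonal_def by auto
    also have "\<dots> / (of_real (sqrt (s i)) * of_real (sqrt (s j))) = (1\<^sub>m n :: complex mat) $$ (i, j)"
      using ij nrm[of i] by (auto simp flip: of_real_mult)
    finally show "(mat_adjoint W * W) $$ (i, j) = (1\<^sub>m n :: complex mat) $$ (i, j)" .
  qed (use W in auto)
  moreover have "col W 0 = (1 / of_real (sqrt (s 0))) \<cdot>\<^sub>v v"
    using n hd v by (auto simp: W_def)
  ultimately show ?thesis using W by blast
qed

definition real_diag :: "nat \<Rightarrow> (nat \<Rightarrow> real) \<Rightarrow> complex mat" where
  "real_diag n l = mat n n (\<lambda>(i, j). if i = j then of_real (l i) else 0)"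

lemma real_diag_carrier [simp]: "real_diag n l \<in> carrier_mat n n"
  by (simp add: real_diag_def)

text \<open>
  By induction on the size. A unitary matrix whose first column is an eigenvector deflates \<open>A\<close>: the
  first column of the conjugated matrix is a multiple of the first unit vector, and so is its first
  row because the matrix is still Hermitian. What remains is a smaller Hermitian block.
\<close>

theorem hermitian_unitarily_diagonalizable:
  fixes A :: "complex mat"
  assumes "A \<in> carrier_mat n n" "mat_adjoint A = A"
  shows "\<exists>U l. U \<in> carrier_mat n n \<and> mat_adjoint U * U = 1\<^sub>m n \<and> A = U * real_diag n l * mat_adjoint U"
  using assms
proof (induction n arbitrary: A)
  case 0
  then show ?case
    by (intro exI[of _ "1\<^sub>m 0"] exI[of _ "\<lambda>_. 0"]) (auto intro!: eq_matI)
next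
  case (Suc m)
  note A = Suc.prems(1) and herm = Suc.prems(2)
  have "degree (char_poly A) = Suc m" using degree_monic_char_poly[OF A] by auto
  then have "\<not> constant (poly (char_poly A))" by (simp add: constant_degree)
  then obtain e where "poly (char_poly A) e = 0" using fundamental_theorem_of_algebra by blast
  then have "eigenvalue A e" using eigenvalue_root_char_poly[OF A] by auto
  then obtain v where v: "v \<in> carrier_vec (Suc m)" "v \<noteq> 0\<^sub>v (Suc m)" "A *\<^sub>v v = e \<cdot>\<^sub>v v"
    using A unfolding eigenvalue_def eigenvector_def by auto
  obtain W c where W: "W \<in> carrier_mat (Suc m) (Suc m)" and unit: "mat_adjoint W * W = 1\<^sub>m (Suc m)"
    and c: "col W 0 = c \<cdot>\<^sub>v v"
    using unitary_completion[OF v(1,2)] by blast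
  note W' = mat_adjoint_carrier[OF W]
  note assoc = assoc_mult_mat[of _ "Suc m" "Suc m" _ "Suc m" _ "Suc m"]
    mult_carrier_mat[of _ "Suc m" "Suc m" _ "Suc m"]
  have unit': "W * mat_adjoint W = 1\<^sub>m (Suc m)" using mat_mult_left_right_inverse[OF W' W unit] .
  define A' where "A' = mat_adjoint W * A * W"
  have A': "A' \<in> carrier_mat (Suc m) (Suc m)" using A W W' by (auto simp: A'_def)
  have herm': "mat_adjoint A' = A'"
    using A W W' herm unfolding A'_def
    by (simp add: mat_adjoint_mult[of _ "Suc m" "Suc m" _ "Suc m"] mat_adjoint_involution
        assoc)
  have entry: "A' $$ (i, 0) = (if i = 0 then e else 0)" if i: "i < Suc m" for i
  proof -
    have Av: "A *\<^sub>v col W 0 = e \<cdot>\<^sub>v col W 0"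
      unfolding c using A v by (simp add: mult_mat_vec smult_smult_assoc mult.commute)
    have "col A' 0 = mat_adjoint W *\<^sub>v (A *\<^sub>v col W 0)"
      unfolding A'_def assoc_mult_mat[OF W' A W]
      by (simp only: col_mult2[OF W' mult_carrier_mat[OF A W] zero_less_Suc] col_mult2[OF A W zero_less_Suc])
    also have "\<dots> = e \<cdot>\<^sub>v (mat_adjoint W *\<^sub>v col W 0)"
      unfolding Av by (rule mult_mat_vec[OF W'], rule carrier_vecI) (use W in simp)
    also have "mat_adjoint W *\<^sub>v col W 0 = col (mat_adjoint W * W) 0"
      by (rule col_mult2[OF W' W, symmetric]) simp
    finally have "col A' 0 $ i = (e \<cdot>\<^sub>v col (1\<^sub>m (Suc m)) 0) $ i" by (simp add: unit)
    then show ?thesis using i A' by auto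
  qed
  have entry': "A' $$ (0, i) = (if i = 0 then cnj e else 0)" if i: "i < Suc m" for i
  proof -
    have "A' $$ (0, i) = mat_adjoint A' $$ (0, i)" by (simp add: herm')
    also have "\<dots> = cnj (A' $$ (i, 0))" using i A' by auto
    finally show ?thesis using entry[OF i] by auto
  qed
  \<comment> \<open>The corner entry lies both in the first column and in the first row.\<close>
  have "cnj e = e" using entry[of 0] entry'[of 0] by simp
  then obtain t where t: "e = of_real t" using Reals_cnj_iff Reals_cases by blast
  define B where "B = mat m m (\<lambda>(i, j). A' $$ (Suc i, Suc j))"
  have B: "B \<in> carrier_mat m m" by (simp add: B_def)
  have "mat_adjoint B = B"
  proof (rule eq_matI)
    fix i j assume ij: "i < dim_row B" "j < dim_col B"
    have "A' $$ (Suc i, Suc j) = mat_adjoint A' $$ (Suc i, Suc j)" by (simp add: herm')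
    also have "\<dots> = cnj (A' $$ (Suc j, Suc i))" using ij A' by (auto simp: B_def)
    finally show "mat_adjoint B $$ (i, j) = B $$ (i, j)" using ij by (auto simp: B_def)
  qed (auto simp: B_def)
  from Suc.IH[OF B this] obtain V l where V: "V \<in> carrier_mat m m"
    and unitV: "mat_adjoint V * V = 1\<^sub>m m" and BV: "B = V * real_diag m l * mat_adjoint V" by blast
  note V' = mat_adjoint_carrier[OF V]
  \<comment> \<open>The unitary diagonalizing the smaller block, extended by the identity on the first coordinate.\<close>
  define F where "F = four_block_mat (1\<^sub>m 1) (0\<^sub>m 1 m) (0\<^sub>m m 1) V"
  define l' where "l' = case_nat t l"
  have F: "F \<in> carrier_mat (Suc m) (Suc m)" using V unfolding F_def by auto
  have adj1: "mat_adjoint (1\<^sub>m 1 :: complex mat) = 1\<^sub>m 1" "mat_adjoint (0\<^sub>m a b :: complex mat) = 0\<^sub>m b a" for a b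
    by (auto intro!: eq_matI)
  have F'eq: "mat_adjoint F = four_block_mat (1\<^sub>m 1) (0\<^sub>m 1 m) (0\<^sub>m m 1) (mat_adjoint V)"
    unfolding F_def by (subst mat_adjoint_four_block[OF _ _ _ V]) (auto simp: adj1)
  note F' = mat_adjoint_carrier[OF F]
  have "mat_adjoint F * F = four_block_mat (1\<^sub>m 1) (0\<^sub>m 1 m) (0\<^sub>m m 1) (1\<^sub>m m)"
    unfolding F'eq unfolding F_def
    using V V' by (subst mult_four_block_mat[of _ 1 1 _ m _ m _ _ 1 _ m]) (auto simp: unitV)
  then have unitF: "mat_adjoint F * F = 1\<^sub>m (Suc m)" by (auto intro!: eq_matI)
  have D: "real_diag (Suc m) l' = four_block_mat (mat 1 1 (\<lambda>_. e)) (0\<^sub>m 1 m) (0\<^sub>m m 1) (real_diag m l)"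
    by (rule eq_matI) (auto simp: real_diag_def l'_def t split: nat.split)
  have FD: "F * real_diag (Suc m) l' = four_block_mat (mat 1 1 (\<lambda>_. e)) (0\<^sub>m 1 m) (0\<^sub>m m 1) (V * real_diag m l)"
    unfolding D F_def using V
    by (subst mult_four_block_mat[of _ 1 1 _ m _ m _ _ 1 _ m])
      (auto simp: left_mult_zero_mat[OF real_diag_carrier])
  have VD: "V * real_diag m l \<in> carrier_mat m m" using V by simp
  have "F * real_diag (Suc m) l' * mat_adjoint F
      = four_block_mat (mat 1 1 (\<lambda>_. e)) (0\<^sub>m 1 m) (0\<^sub>m m 1) B"
    unfolding FD F'eq BV
    by (subst mult_four_block_mat[of _ 1 1 _ m _ m _ _ 1 _ m])
      (use VD V' in \<open>auto simp: left_mult_zero_mat[OF V'] right_mult_zero_mat[OF VD]\<close>)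
  also have "\<dots> = A'"
    using A' entry entry' \<open>cnj e = e\<close> by (intro eq_matI) (auto simp: B_def)
  finally have A'eq: "A' = F * real_diag (Suc m) l' * mat_adjoint F" ..
  have "W * F * real_diag (Suc m) l' * mat_adjoint (W * F) = W * (F * real_diag (Suc m) l' * mat_adjoint F) * mat_adjoint W"
    using W F W' F' by (simp add: mat_adjoint_mult[OF W F] assoc)
  also have "\<dots> = (W * mat_adjoint W) * A * (W * mat_adjoint W)"
    unfolding A'eq[symmetric] A'_def
    using W W' A by (simp add: assoc)
  also have "\<dots> = A" unfolding unit' using A by simp
  finally have "A = W * F * real_diag (Suc m) l' * mat_adjoint (W * F)" ..
  moreover have "mat_adjoint (W * F) * (W * F) = mat_adjoint F * (mat_adjoint W * W) * F"
    using W F W' F' by (simp add: mat_adjoint_mult[OF W F] assoc)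
  then have "mat_adjoint (W * F) * (W * F) = 1\<^sub>m (Suc m)" using right_mult_one_mat[OF F'] unitF unit by simp
  ultimately show ?case using mult_carrier_mat[OF W F] by blast
qed

section \<open>Inertia from a diagonalization\<close>

lemma order_prod_linear_factors:
  fixes l :: "nat \<Rightarrow> 'a :: field"
  shows "Polynomial.order x (\<Prod>k<n. [:- l k, 1:]) = card {k. k < n \<and> l k = x}"
proof (induction n)
  case (Suc n)
  let ?p = "\<Prod>k<n. [:- l k, 1:]" and ?q = "[:- l n, 1:]"
  have nz: "?p * ?q \<noteq> 0" unfolding mult_eq_0_iff by (simp add: prod_zero_iff)
  have q: "Polynomial.order x ?q = (if l n = x then 1 else 0)"
  proof (cases "l n = x")
    case True
    then show ?thesis using order_power_n_n[of x 1] unfolding power_one_right by simp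
  next
    case False
    then have "Polynomial.order x ?q = 0" by (intro order_0I) simp
    then show ?thesis using False by (simp only: if_False)
  qed
  have "{k. k < Suc n \<and> l k = x} = (if l n = x then insert n {k. k < n \<and> l k = x} else {k. k < n \<and> l k = x})"
    by (auto simp: less_Suc_eq)
  then have card: "card {k. k < Suc n \<and> l k = x} = card {k. k < n \<and> l k = x} + (if l n = x then 1 else 0)"
    by simp
  show ?case unfolding prod.lessThan_Suc order_mult[OF nz] q Suc card ..
qed simp

text \<open>
  The diagonalization takes place over the complex numbers, whereas multiplicities are counted in the
  real characteristic polynomial. Both factorizations agree because embedding the coefficients is an
  injective ring homomorphism.
\<close>

lemma char_poly_real_diagonalized:
  fixes A :: "real mat"
  assumes A: "A \<in> carrier_mat n n" and U: "U \<in> carrier_mat n n" "mat_adjoint U * U = 1\<^sub>m n"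
    and eq: "map_mat complex_of_real A = U * real_diag n l * mat_adjoint U"
  shows "char_poly A = (\<Prod>k<n. [:- l k, 1:])"
proof -
  interpret h: map_poly_inj_comm_ring_hom complex_of_real ..
  note U' = mat_adjoint_carrier[OF U(1)]
  have "similar_mat_wit (map_mat complex_of_real A) (real_diag n l) U (mat_adjoint U)"
    by (rule similar_mat_witI[OF mat_mult_left_right_inverse[OF U' U] U(2) eq _ real_diag_carrier U(1) U'])
      (simp add: A)
  then have "char_poly (map_mat complex_of_real A) = char_poly (real_diag n l)"
    by (intro char_poly_similar) (auto simp: similar_mat_def)
  also have "\<dots> = (\<Prod>a\<leftarrow>diag_mat (real_diag n l). [:- a, 1:])"
    by (rule char_poly_upper_triangular[of _ n]) (auto simp: real_diag_def)
  also have "\<dots> = (\<Prod>k<n. [:- complex_of_real (l k), 1:])"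
  proof -
    have "diag_mat (real_diag n l) = map (\<lambda>k. complex_of_real (l k)) [0..<n]"
      by (auto simp: diag_mat_def real_diag_def)
    then show ?thesis
      using prod.distinct_set_conv_list[OF distinct_upt, of "\<lambda>k. [:- complex_of_real (l k), 1:]" 0 n]
      by (simp only: map_map comp_def set_upt atLeast0LessThan)
  qed
  also have "\<dots> = map_poly complex_of_real (\<Prod>k<n. [:- l k, 1:])"
    by (simp add: h.hom_prod)
  finally have "map_poly complex_of_real (char_poly A) = map_poly complex_of_real (\<Prod>k<n. [:- l k, 1:])"
    by (simp add: of_real_hom.char_poly_hom[OF A])
  then show ?thesis by (simp only: h.eq_iff)
qed

lemma count_eigenvalues_eq_card:
  assumes A: "A \<in> carrier_mat n n" and cp: "char_poly A = (\<Prod>k<n. [:- l k, 1:])"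
  shows "count_eigenvalues Q A = card {k. k < n \<and> Q (l k)}"
proof -
  have ev: "{x. eigenvalue A x \<and> Q x} = {x. Q x} \<inter> l ` {..<n}"
    by (auto simp: eigenvalue_root_char_poly[OF A] cp poly_prod)
  have "count_eigenvalues Q A = (\<Sum>x\<in>{x. Q x} \<inter> l ` {..<n}. card {k. k < n \<and> l k = x})"
    unfolding count_eigenvalues_def ev cp by (simp only: order_prod_linear_factors)
  also have "\<dots> = card (\<Union>x\<in>{x. Q x} \<inter> l ` {..<n}. {k. k < n \<and> l k = x})"
    by (rule card_UN_disjoint[symmetric]) auto
  also have "(\<Union>x\<in>{x. Q x} \<inter> l ` {..<n}. {k. k < n \<and> l k = x}) = {k. k < n \<and> Q (l k)}" by auto
  finally show ?thesis .
qed

section \<open>Rank and trace of idempotent matrices\<close>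

text \<open>
  Take the columns of \<open>X\<close> to be a maximal independent set of columns of \<open>P\<close>; expanding every column
  of \<open>P\<close> in them gives \<open>P = X Z\<close>. Idempotency makes \<open>P\<close> fix its own columns, hence \<open>X Z X = X\<close>, and
  \<open>X\<close> can be cancelled on the left because its columns are independent. The left inverse \<open>Z\<close> is how
  injectivity of \<open>X\<close> will be used.
\<close>

lemma idempotent_factorization:
  fixes P :: "'a :: field mat"
  assumes P: "P \<in> carrier_mat d d" and idem: "P * P = P" and r: "vec_space.rank d P = r"
  shows "\<exists>X Z. X \<in> carrier_mat d r \<and> Z \<in> carrier_mat r d \<and> P = X * Z \<and> Z * X = 1\<^sub>m r"
proof -
  interpret vec_space "TYPE('a)" d .
  obtain S where max: "maximal S (\<lambda>T. T \<subseteq> set (cols P) \<and> lin_indpt T)" "finite S"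
    using maximal_exists_superset[of "set (cols P)" "\<lambda>T. T \<subseteq> set (cols P) \<and> lin_indpt T" "{}"]
      by (auto simp: lin_dep_def)
  have cP: "set (cols P) \<subseteq> carrier_vec d" using cols_dim P by blast
  have S: "S \<subseteq> set (cols P)" "lin_indpt S" "card S = r"
    using max rank_card_indpt[OF P max(1)] r unfolding maximal_def by auto
  have Sc: "S \<subseteq> carrier_vec d" using S cP by auto
  obtain xs where xs: "set xs = S" "distinct xs" using finite_distinct_list[OF max(2)] by blast
  have len: "length xs = r" using xs S distinct_card by metis
  define X where "X = mat_of_cols d xs"
  have X: "X \<in> carrier_mat d r" unfolding X_def using len by auto
  have colsX: "cols X = xs" unfolding X_def by (rule cols_mat_of_cols) (use xs Sc in auto)
  have inj: "y = 0\<^sub>v r" if "y \<in> carrier_vec r" "X *\<^sub>v y = 0\<^sub>v d" for y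
    using lin_depI[OF X that(1) _ that(2)] S(2) xs unfolding colsX by auto
  have "\<exists>z \<in> carrier_vec r. X *\<^sub>v z = c" if c: "c \<in> set (cols P)" for c
  proof -
    have "c \<in> span S"
    proof (rule ccontr)
      assume n: "c \<notin> span S"
      then have "c \<notin> S" using span_mem[of S] Sc by auto
      moreover have "lin_indpt (S \<union> {c})"
        using lin_dep_iff_in_span[of S c] n Sc S(2) c cP \<open>c \<notin> S\<close> by auto
      ultimately show False using max(1) S c unfolding maximal_def by blast
    qed
    then have "c \<in> span_list xs" using span_list_as_span[of xs] xs Sc by auto
    then obtain f where "c = lincomb_list f xs" unfolding span_list_def by auto
    also have "\<dots> = X *\<^sub>v vec (length xs) f"
      unfolding X_def by (rule lincomb_list_as_mat_mult) (use xs Sc in auto)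
    finally show ?thesis using len by (intro bexI[of _ "vec (length xs) f"]) auto
  qed
  then have "\<forall>j<d. \<exists>z \<in> carrier_vec r. X *\<^sub>v z = col P j"
    using P by (metis carrier_matD(2) cols_length cols_nth nth_mem)
  then obtain z where z: "\<And>j. j < d \<Longrightarrow> z j \<in> carrier_vec r \<and> X *\<^sub>v z j = col P j" by metis
  define Z where "Z = mat r d (\<lambda>(i, j). z j $ i)"
  have Z: "Z \<in> carrier_mat r d" by (simp add: Z_def)
  have colZ: "col Z j = z j" if "j < d" for j
    using z[OF that] that by (intro eq_vecI) (auto simp: Z_def)
  have PXZ: "P = X * Z"
  proof (rule mat_col_eqI)
    fix j assume "j < dim_col (X * Z)"
    then have j: "j < d" using Z by auto
    show "col P j = col (X * Z) j" unfolding col_mult2[OF X Z j] colZ[OF j] using z[OF j] by simp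
  qed (use P X Z in auto)
  have PX: "P * X = X"
  proof (rule mat_col_eqI)
    fix j assume "j < dim_col X"
    then have j: "j < r" using X by auto
    have "col X j \<in> S" using colsX xs j len X by (metis carrier_matD(2) cols_nth nth_mem)
    then obtain i where i: "i < d" "col X j = col P i"
      using S P by (metis carrier_matD(2) cols_length cols_nth in_set_conv_nth subsetD)
    have "col (P * X) j = P *\<^sub>v col P i" using col_mult2[OF P X j] i by simp
    also have "\<dots> = col (P * P) i" using col_mult2[OF P P i(1)] by simp
    finally show "col (P * X) j = col X j" using idem i by simp
  qed (use P X in auto)
  have "Z * X = 1\<^sub>m r"
  proof (rule mat_col_eqI)
    fix j assume "j < dim_col (1\<^sub>m r :: 'a mat)"
    then have j: "j < r" by auto
    have ZXj: "col (Z * X) j \<in> carrier_vec r" by (rule carrier_vecI) (use Z in simp)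
    define y where "y = col (Z * X) j - col (1\<^sub>m r) j"
    have y: "y \<in> carrier_vec r" by (rule carrier_vecI) (simp add: y_def)
    have "X *\<^sub>v y = X *\<^sub>v col (Z * X) j - X *\<^sub>v col (1\<^sub>m r) j"
      unfolding y_def by (rule mult_minus_distrib_mat_vec[OF X ZXj]) (use j in simp)
    also have "X *\<^sub>v col (Z * X) j = col (X * (Z * X)) j"
      by (rule col_mult2[OF X _ j, symmetric]) (use Z X in auto)
    also have "X * (Z * X) = X" using PX PXZ X Z by (metis assoc_mult_mat)
    also have "X *\<^sub>v col (1\<^sub>m r) j = col X j"
      using col_mult2[OF X one_carrier_mat j] X by simp
    also have "col X j - col X j = 0\<^sub>v d" using X j by auto
    finally have "y = 0\<^sub>v r" using inj[OF y] by simp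
    show "col (Z * X) j = col (1\<^sub>m r) j"
    proof (rule eq_vecI)
      fix i assume "i < dim_vec (col (1\<^sub>m r :: 'a mat) j)"
      then have "(col (Z * X) j - col (1\<^sub>m r) j) $ i = 0" using \<open>y = 0\<^sub>v r\<close> y_def by simp
      then show "col (Z * X) j $ i = col (1\<^sub>m r) j $ i"
        using \<open>i < dim_vec _\<close> by simp
    qed (use Z in simp)
  qed (use Z X in auto)
  then show ?thesis using X Z PXZ by blast
qed

definition mat_trace :: "'a :: comm_monoid_add mat \<Rightarrow> 'a" where
  "mat_trace A = (\<Sum>i<dim_row A. A $$ (i, i))"

lemma mat_trace_mult_commute:
  fixes A B :: "'a :: comm_semiring_0 mat"
  assumes "A \<in> carrier_mat m n" "B \<in> carrier_mat n m"
  shows "mat_trace (A * B) = mat_trace (B * A)"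
proof -
  have "mat_trace (A * B) = (\<Sum>i<m. \<Sum>j<n. A $$ (i, j) * B $$ (j, i))"
    using assms by (auto simp: mat_trace_def scalar_prod_def atLeast0LessThan intro!: sum.cong)
  also have "\<dots> = (\<Sum>j<n. \<Sum>i<m. B $$ (j, i) * A $$ (i, j))"
    by (subst sum.swap) (simp add: mult.commute)
  also have "\<dots> = mat_trace (B * A)"
    using assms by (auto simp: mat_trace_def scalar_prod_def atLeast0LessThan intro!: sum.cong)
  finally show ?thesis .
qed

text \<open>
  With \<open>P = X Z\<close> and \<open>Z X = 1\<close> the trace of \<open>P\<close> is that of an identity matrix of size \<open>rank P\<close>. Unlike the
  rank, the trace can be computed from the entries and is visibly additive on block diagonal matrices.
\<close>

lemma trace_idempotent_eq_rank:
  fixes P :: "'a :: field mat"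
  assumes "P \<in> carrier_mat d d" "P * P = P"
  shows "mat_trace P = of_nat (vec_space.rank d P)"
proof -
  obtain X Z where XZ: "X \<in> carrier_mat d (vec_space.rank d P)" "Z \<in> carrier_mat (vec_space.rank d P) d"
    "P = X * Z" "Z * X = 1\<^sub>m (vec_space.rank d P)"
    using idempotent_factorization[OF assms refl] by blast
  then show ?thesis
    using mat_trace_mult_commute[OF XZ(1,2)] by (auto simp: mat_trace_def)
qed

section \<open>Direct sums of representations and the projective rank\<close>

lemma trace_orthogonal_projector:
  assumes "orthogonal_projector d P"
  shows "mat_trace P = of_nat (vec_space.rank d P)"
  using assms trace_idempotent_eq_rank[of P d] by (auto simp: orthogonal_projector_def)

lemma orthogonal_projector_direct_sum:
  assumes "orthogonal_projector d1 P1" "orthogonal_projector d2 P2"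
  shows "orthogonal_projector (d1 + d2) (four_block_mat P1 (0\<^sub>m d1 d2) (0\<^sub>m d2 d1) P2)"
    and "vec_space.rank (d1 + d2) (four_block_mat P1 (0\<^sub>m d1 d2) (0\<^sub>m d2 d1) P2)
      = vec_space.rank d1 P1 + vec_space.rank d2 P2"
proof -
  let ?P = "four_block_mat P1 (0\<^sub>m d1 d2) (0\<^sub>m d2 d1) P2"
  have P: "P1 \<in> carrier_mat d1 d1" "P2 \<in> carrier_mat d2 d2" "P1 * P1 = P1" "P2 * P2 = P2"
    "mat_adjoint P1 = P1" "mat_adjoint P2 = P2"
    using assms by (auto simp: orthogonal_projector_def)
  have adj: "mat_adjoint (0\<^sub>m a b :: complex mat) = 0\<^sub>m b a" for a b
    by (auto intro!: eq_matI)
  have "?P * ?P = ?P"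
    by (subst mult_four_block_mat[of _ d1 d1 _ d2 _ d2 _ _ d1 _ d2])
      (use P in \<open>auto simp: left_mult_zero_mat[OF P(1)] left_mult_zero_mat[OF P(2)]
         right_mult_zero_mat[OF P(1)] right_mult_zero_mat[OF P(2)]\<close>)
  moreover have "mat_adjoint ?P = ?P"
    using P by (subst mat_adjoint_four_block[of _ d1 d1 _ d2 _ d2]) (auto simp: adj)
  ultimately show proj: "orthogonal_projector (d1 + d2) ?P"
    using P by (auto simp: orthogonal_projector_def)
  have "mat_trace ?P = (\<Sum>i<d1. ?P $$ (i, i)) + (\<Sum>i=d1..<d1 + d2. ?P $$ (i, i))"
    using P sum.atLeastLessThan_concat[of 0 d1 "d1 + d2" "\<lambda>i. ?P $$ (i, i)"]
    unfolding mat_trace_def atLeast0LessThan[symmetric] by simp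
  also have "(\<Sum>i<d1. ?P $$ (i, i)) = mat_trace P1"
    using P by (auto simp: mat_trace_def intro!: sum.cong)
  also have "(\<Sum>i=d1..<d1 + d2. ?P $$ (i, i)) = (\<Sum>i=0..<d2. ?P $$ (i + d1, i + d1))"
    using sum.shift_bounds_nat_ivl[of "\<lambda>i. ?P $$ (i, i)" 0 d1 d2] by (simp add: add.commute)
  also have "\<dots> = mat_trace P2"
    using P by (auto simp: mat_trace_def atLeast0LessThan intro!: sum.cong)
  finally have "(of_nat (vec_space.rank (d1 + d2) ?P) :: complex)
      = of_nat (vec_space.rank d1 P1 + vec_space.rank d2 P2)"
    unfolding trace_orthogonal_projector[OF proj] trace_orthogonal_projector[OF assms(1)]
      trace_orthogonal_projector[OF assms(2)] of_nat_add .
  then show "vec_space.rank (d1 + d2) ?P = vec_space.rank d1 P1 + vec_space.rank d2 P2"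
    unfolding of_nat_eq_iff .
qed

lemma is_representation_direct_sum:
  assumes wf: "pair_wf_digraph G"
    and 1: "is_representation G d1 r1 P1" and 2: "is_representation G d2 r2 P2"
  shows "is_representation G (d1 + d2) (r1 + r2)
    (\<lambda>v. four_block_mat (P1 v) (0\<^sub>m d1 d2) (0\<^sub>m d2 d1) (P2 v))"
proof -
  interpret pair_wf_digraph G by fact
  have "four_block_mat (P1 v) (0\<^sub>m d1 d2) (0\<^sub>m d2 d1) (P2 v)
      * four_block_mat (P1 w) (0\<^sub>m d1 d2) (0\<^sub>m d2 d1) (P2 w) = 0\<^sub>m (d1 + d2) (d1 + d2)"
    if e: "(v, w) \<in> parcs G" for v w
  proof -
    have vw: "v \<in> pverts G" "w \<in> pverts G" using in_arcsD1[OF e] in_arcsD2[OF e] by auto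
    have c: "P1 v \<in> carrier_mat d1 d1" "P1 w \<in> carrier_mat d1 d1"
      "P2 v \<in> carrier_mat d2 d2" "P2 w \<in> carrier_mat d2 d2"
      and z: "P1 v * P1 w = 0\<^sub>m d1 d1" "P2 v * P2 w = 0\<^sub>m d2 d2"
      using 1 2 e vw by (auto simp: is_representation_def orthogonal_projector_def)
    show ?thesis
      using c z by (subst mult_four_block_mat[of _ d1 d1 _ d2 _ d2 _ _ d1 _ d2])
        (auto simp: left_mult_zero_mat[OF c(2)] left_mult_zero_mat[OF c(4)]
         right_mult_zero_mat[OF c(1)] right_mult_zero_mat[OF c(3)])
  qed
  then show ?thesis
    using 1 2 orthogonal_projector_direct_sum by (auto simp: is_representation_def)
qed

text \<open>
  Sending the vertices to the coordinate projections of \<open>\<complex>\<^sup>n\<close> is a representation because the graph has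
  no loops. It guarantees that the minimum defining the orthogonal rank is taken over a nonempty set.
\<close>

lemma standard_representation:
  assumes "pair_loopfree_digraph G" and fin: "finite (pverts G)"
  shows "\<exists>P. is_representation G (card (pverts G)) 1 P"
proof -
  interpret pair_loopfree_digraph G by fact
  define n where "n = card (pverts G)"
  obtain h where h: "bij_betw h (pverts G) {0..<n}"
    using ex_bij_betw_finite_nat[OF fin] unfolding n_def by blast
  have hn: "h v < n" if "v \<in> pverts G" for v using bij_betwE[OF h] that by auto
  define P :: "'a \<Rightarrow> complex mat" where "P v = mat n n (\<lambda>(i, j). if i = j \<and> i = h v then 1 else 0)" for v
  have mult: "P v * P w = mat n n (\<lambda>(i, j). if i = j \<and> i = h v \<and> i = h w then 1 else 0)" for v w
  proof (rule eq_matI)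
    fix i j assume "i < dim_row (mat n n (\<lambda>(i, j). if i = j \<and> i = h v \<and> i = h w then 1 else 0 :: complex))"
      "j < dim_col (mat n n (\<lambda>(i, j). if i = j \<and> i = h v \<and> i = h w then 1 else 0 :: complex))"
    then have ij: "i < n" "j < n" by auto
    have "(P v * P w) $$ (i, j) = (\<Sum>k\<in>{0..<n}. P v $$ (i, k) * P w $$ (k, j))"
      using ij by (simp add: P_def scalar_prod_def)
    also have "\<dots> = (\<Sum>k\<in>{0..<n}. if k = i then (if i = h v \<and> i = j \<and> i = h w then 1 else 0) else 0)"
      using ij by (intro sum.cong) (auto simp: P_def)
    finally show "(P v * P w) $$ (i, j) = mat n n (\<lambda>(i, j). if i = j \<and> i = h v \<and> i = h w then 1 else 0) $$ (i, j)"
      using ij by (auto simp: sum.delta)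
  qed (auto simp: P_def)
  have proj: "orthogonal_projector n (P v)" for v
    unfolding orthogonal_projector_def
    by (auto simp: mult) (auto simp: P_def intro!: eq_matI)
  moreover have "vec_space.rank n (P v) = 1" if "v \<in> pverts G" for v
  proof -
    have "mat_trace (P v) = 1" using hn[OF that] by (simp add: mat_trace_def P_def sum.delta)
    then show ?thesis by (simp add: trace_orthogonal_projector[OF proj])
  qed
  moreover have "P v * P w = 0\<^sub>m n n" if e: "(v, w) \<in> parcs G" for v w
  proof -
    have "v \<in> pverts G" "w \<in> pverts G" "v \<noteq> w"
      using in_arcsD1[OF e] in_arcsD2[OF e] pair_no_loops[OF e] by auto
    then have "h v \<noteq> h w" using h by (auto simp: bij_betw_def inj_on_def)
    then show ?thesis unfolding mult by (auto intro!: eq_matI)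
  qed
  ultimately show ?thesis unfolding is_representation_def n_def by blast
qed

lemma orthogonal_rank_attained:
  assumes G: "pair_graph G" "pverts G \<noteq> {}" and r: "0 < r"
  shows "0 < orthogonal_rank r G" "\<exists>P. is_representation G (orthogonal_rank r G) r P"
proof -
  interpret pair_graph G by fact
  have lf: "pair_loopfree_digraph G" and wf: "pair_wf_digraph G" by unfold_locales
  note fin = pair_finite_verts
  \<comment> \<open>Repeat the standard representation \<open>r\<close> times.\<close>
  have "\<exists>P. is_representation G (r * card (pverts G)) r P"
    using r
  proof (induction r rule: nat_induct_non_zero)
    case 1
    then show ?case using standard_representation[OF lf fin] by simp
  next
    case (Suc r)
    obtain P where P: "is_representation G (r * card (pverts G)) r P" using Suc by blast
    obtain Q where Q: "is_representation G (card (pverts G)) 1 Q"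
      using standard_representation[OF lf fin] by blast
    show ?case using is_representation_direct_sum[OF wf P Q] by (auto simp: add.commute)
  qed
  then have "\<exists>d. 0 < d \<and> (\<exists>P. is_representation G d r P)"
    using G fin r by (metis card_gt_0_iff mult_pos_pos)
  from LeastI_ex[OF this]
  show "0 < orthogonal_rank r G" "\<exists>P. is_representation G (orthogonal_rank r G) r P"
    unfolding orthogonal_rank_def by auto
qed

lemma orthogonal_rank_subadditive:
  assumes G: "pair_graph G" "pverts G \<noteq> {}" and rs: "0 < r" "0 < s"
  shows "orthogonal_rank (r + s) G \<le> orthogonal_rank r G + orthogonal_rank s G"
proof -
  interpret pair_graph G by fact
  have wf: "pair_wf_digraph G" by unfold_locales
  obtain P where P: "is_representation G (orthogonal_rank r G) r P"
    using orthogonal_rank_attained(2)[OF G rs(1)] by blast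
  obtain Q where Q: "is_representation G (orthogonal_rank s G) s Q"
    using orthogonal_rank_attained(2)[OF G rs(2)] by blast
  from is_representation_direct_sum[OF wf P Q] show ?thesis
    using orthogonal_rank_attained(1)[OF G rs(1)]
    unfolding orthogonal_rank_def[of "r + s"] by (intro Least_le) auto
qed

text \<open>
  Fekete's lemma for nonnegative sequences; subadditivity is asked for positive arguments only. The
  limit is the infimum \<open>L\<close> of the ratios. If \<open>a m / m\<close> is close to \<open>L\<close>, write \<open>n = q m + s\<close> with
  \<open>1 \<le> s \<le> m\<close>; then \<open>a n / n\<close> exceeds \<open>a m / m\<close> by at most \<open>M / n\<close>, where \<open>M\<close> bounds \<open>a\<close> on \<open>{1..m}\<close>.
\<close>

lemma subadditive_ratio_convergent:
  fixes a :: "nat \<Rightarrow> real"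
  assumes sub: "\<And>m n. 0 < m \<Longrightarrow> 0 < n \<Longrightarrow> a (m + n) \<le> a m + a n"
    and nonneg: "\<And>n. 0 \<le> a n"
  shows "convergent (\<lambda>n. a n / real n)"
proof -
  define S where "S = (\<lambda>n. a n / real n) ` {0<..}"
  define L where "L = Inf S"
  have bdd: "bdd_below S" unfolding S_def by (intro bdd_belowI[of _ 0]) (auto intro!: divide_nonneg_nonneg nonneg)
  have lower: "L \<le> a n / real n" if "0 < n" for n
    unfolding L_def by (intro cInf_lower bdd) (use that in \<open>auto simp: S_def\<close>)
  have multiple: "a (q * m + s) \<le> real q * a m + a s" if "0 < m" "0 < s" for q m s
  proof (induction q)
    case (Suc q)
    have "a (Suc q * m + s) = a (m + (q * m + s))" by (simp add: add.assoc)
    also have "\<dots> \<le> a m + a (q * m + s)" by (rule sub) (use that in auto)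
    finally show ?case using Suc by (simp add: algebra_simps)
  qed auto
  have "(\<lambda>n. a n / real n) \<longlonglongrightarrow> L"
  proof (rule LIMSEQ_I)
    fix e :: real assume e: "0 < e"
    have "\<exists>x\<in>S. x < L + e / 2"
      unfolding L_def by (rule cInf_lessD) (use e in \<open>auto simp: S_def\<close>)
    then obtain m where m: "0 < m" "a m / real m < L + e / 2" by (auto simp: S_def)
    define M where "M = Max (a ` {1..m})"
    have M: "a s \<le> M" if "1 \<le> s" "s \<le> m" for s
      unfolding M_def using that by (intro Max_ge) auto
    have M0: "0 \<le> M" using M[of 1] m nonneg[of 1] by auto
    have upper: "a n / real n \<le> a m / real m + M / real n" if n: "0 < n" for n
    proof -
      \<comment> \<open>The remainder is shifted into \<open>{1..m}\<close>, where subadditivity applies.\<close>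
      define q s where "q = (n - 1) div m" and "s = (n - 1) mod m + 1"
      have nq: "n = q * m + s" unfolding q_def s_def using n by simp
      have s: "1 \<le> s" "s \<le> m" unfolding s_def using m by (auto simp: Suc_leI)
      have "a n \<le> real q * a m + M" using multiple[of m s q] M[OF s] nq m s by auto
      moreover have "real q * a m \<le> real n * (a m / real m)"
      proof -
        have "real q * real m \<le> real n" unfolding nq by simp
        then have "real q * real m * (a m / real m) \<le> real n * (a m / real m)"
          by (rule mult_right_mono) (simp add: nonneg)
        then show ?thesis using m by simp
      qed
      ultimately have "a n \<le> real n * (a m / real m) + M" by linarith
      then have "a n / real n \<le> (real n * (a m / real m) + M) / real n" by (rule divide_right_mono) simp
      then show ?thesis using n by (simp add: add_divide_distrib)
    qed
    show "\<exists>no. \<forall>n\<ge>no. norm (a n / real n - L) < e"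
    proof (intro exI[of _ "nat \<lceil>2 * M / e\<rceil> + 1"] allI impI)
      fix n assume n: "nat \<lceil>2 * M / e\<rceil> + 1 \<le> n"
      then have "2 * M / e < real n" by linarith
      then have "M / real n < e / 2" using e n by (simp add: field_simps)
      moreover have "0 < n" using n by simp
      ultimately show "norm (a n / real n - L) < e"
        unfolding real_norm_def abs_less_iff
        using upper[of n] lower[of n] m(2) e by linarith
    qed
  qed
  then show ?thesis by (rule convergentI)
qed

lemma projective_rank_limit:
  assumes "pair_graph G" "pverts G \<noteq> {}"
  shows "(\<lambda>r. real (orthogonal_rank r G) / real r) \<longlonglongrightarrow> projective_rank G"
proof -
  have "convergent (\<lambda>r. real (orthogonal_rank r G) / real r)"
  proof (rule subadditive_ratio_convergent)
    fix m n :: nat assume "0 < m" "0 < n"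
    from orthogonal_rank_subadditive[OF assms this]
    show "real (orthogonal_rank (m + n) G) \<le> real (orthogonal_rank m G) + real (orthogonal_rank n G)"
      by linarith
  qed simp
  then show ?thesis unfolding projective_rank_def convergent_LIMSEQ_iff .
qed

section \<open>Isotropic vectors of a Hermitian form\<close>

text \<open>
  Padding the system with zero rows to a square one gives a matrix with determinant zero. Arbitrary
  finite index sets are allowed because the unknowns and equations below are indexed by pairs.
\<close>

lemma underdetermined_system:
  fixes c :: "'i \<Rightarrow> 'j \<Rightarrow> 'a :: field"
  assumes fin: "finite I" "finite J" and less: "card I < card J"
  shows "\<exists>y. (\<exists>j\<in>J. y j \<noteq> 0) \<and> (\<forall>i\<in>I. (\<Sum>j\<in>J. c i j * y j) = 0)"
proof -
  define m where "m = card J"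
  obtain f where f: "bij_betw f {0..<card I} I" using ex_bij_betw_nat_finite[OF fin(1)] by blast
  obtain g where g: "bij_betw g {0..<m} J" using ex_bij_betw_nat_finite[OF fin(2)] unfolding m_def by blast
  define M where "M = mat m m (\<lambda>(i, j). if i < card I then c (f i) (g j) else 0)"
  have M: "M \<in> carrier_mat m m" by (simp add: M_def)
  have I: "card I < m" using less by (simp add: m_def)
  have "det M = (\<Sum>j<m. M $$ (card I, j) * cofactor M (card I) j)"
    by (rule laplace_expansion_row[OF M I])
  also have "\<dots> = 0" using I by (intro sum.neutral) (simp add: M_def)
  finally obtain v where v: "v \<in> carrier_vec m" "v \<noteq> 0\<^sub>v m" "M *\<^sub>v v = 0\<^sub>v m"
    using det_0_iff_vec_prod_zero_field[OF M] by blast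
  define y where "y j = v $ (the_inv_into {0..<m} g j)" for j
  have yg: "y (g k) = v $ k" if "k < m" for k
    unfolding y_def using g that by (subst the_inv_into_f_f) (auto simp: bij_betw_def)
  obtain k where k: "k < m" "v $ k \<noteq> 0"
    using v(1,2) by (metis carrier_vecD eq_vecI index_zero_vec(1,2))
  have "\<exists>j\<in>J. y j \<noteq> 0"
    using yg[OF k(1)] k bij_betwE[OF g] by (intro bexI[of _ "g k"]) auto
  moreover have "(\<Sum>j\<in>J. c i j * y j) = 0" if i: "i \<in> I" for i
  proof -
    obtain p where p: "p < card I" "f p = i" using f i by (metis atLeastLessThan_iff bij_betw_def imageE)
    have "(\<Sum>j\<in>J. c i j * y j) = (\<Sum>k\<in>{0..<m}. c i (g k) * y (g k))"
      by (rule sum.reindex_bij_betw[OF g, symmetric])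
    also have "\<dots> = (M *\<^sub>v v) $ p"
      using p I v(1) by (auto simp: M_def scalar_prod_def yg intro!: sum.cong)
    also have "\<dots> = 0" using v(3) p I by simp
    finally show ?thesis .
  qed
  ultimately show ?thesis by blast
qed

lemma orthogonal_range_inner:
  fixes X Y :: "complex mat"
  assumes X: "X \<in> carrier_mat d r" and Y: "Y \<in> carrier_mat d s" and orth: "mat_adjoint Y * X = 0\<^sub>m s r"
    and "x \<in> carrier_vec r" "y \<in> carrier_vec s"
  shows "(\<Sum>a<d. (X *\<^sub>v x) $ a * cnj ((Y *\<^sub>v y) $ a)) = 0"
proof -
  have gram: "(\<Sum>a<d. X $$ (a, p) * cnj (Y $$ (a, q))) = 0" if "p < r" "q < s" for p q
  proof -
    have "(\<Sum>a<d. X $$ (a, p) * cnj (Y $$ (a, q))) = (mat_adjoint Y * X) $$ (q, p)"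
      using X Y that by (auto simp: scalar_prod_def atLeast0LessThan intro!: sum.cong)
    then show ?thesis using orth that by simp
  qed
  have "(\<Sum>a<d. (X *\<^sub>v x) $ a * cnj ((Y *\<^sub>v y) $ a)) =
      (\<Sum>a<d. (\<Sum>p<r. X $$ (a, p) * x $ p) * (\<Sum>q<s. cnj (Y $$ (a, q)) * cnj (y $ q)))"
    using assms by (auto simp: scalar_prod_def atLeast0LessThan intro!: sum.cong)
  also have "\<dots> = (\<Sum>a<d. \<Sum>p<r. \<Sum>q<s. x $ p * cnj (y $ q) * (X $$ (a, p) * cnj (Y $$ (a, q))))"
    unfolding sum_product by (simp add: ac_simps)
  also have "\<dots> = (\<Sum>p<r. \<Sum>q<s. \<Sum>a<d. x $ p * cnj (y $ q) * (X $$ (a, p) * cnj (Y $$ (a, q))))"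
    by (subst sum.swap, rule sum.cong[OF refl], rule sum.swap)
  also have "\<dots> = 0"
    unfolding sum_distrib_left[symmetric] by (intro sum.neutral ballI) (simp add: gram)
  finally show ?thesis .
qed

text \<open>
  Think of \<open>a\<^sub>i\<^sub>j = \<Sum>\<^sub>k l\<^sub>k U\<^sub>i\<^sub>k cnj U\<^sub>j\<^sub>k\<close> as a Hermitian matrix, with \<open>K\<close> a set of eigenvalues of one
  strict sign (the sign of \<open>s\<close>). Put \<open>x\<^sub>i = X\<^sub>i y\<^sub>i\<close> for \<open>y\<^sub>i \<in> \<complex>\<^sup>r\<close>, and let
  \<open>z\<^sub>k = \<Sum>\<^sub>i cnj U\<^sub>i\<^sub>k x\<^sub>i \<in> \<complex>\<^sup>d\<close> be the coordinates of \<open>x\<close> in the eigenbasis. If the bound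
  failed, the \<open>d (n - |K|)\<close> equations \<open>z\<^sub>k = 0\<close> for \<open>k \<notin> K\<close> in the \<open>r n\<close> unknowns \<open>y\<close> would have a
  nonzero solution. But \<open>\<Sum>\<^sub>k l\<^sub>k |z\<^sub>k|\<^sup>2 = \<Sum>\<^sub>i\<^sub>j a\<^sub>i\<^sub>j \<langle>x\<^sub>j, x\<^sub>i\<rangle> = 0\<close>, as \<open>a\<^sub>i\<^sub>j \<noteq> 0\<close> forces orthogonal
  ranges. All nonzero terms on the left have the same sign, so \<open>z = 0\<close>, hence \<open>x = 0\<close> and \<open>y = 0\<close>.
\<close>

lemma isotropic_dimension_bound:
  fixes U :: "nat \<Rightarrow> nat \<Rightarrow> complex" and X Z :: "nat \<Rightarrow> complex mat" and l :: "nat \<Rightarrow> real" and s :: real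
  assumes complete: "\<And>i j. i < n \<Longrightarrow> j < n \<Longrightarrow> (\<Sum>k<n. U i k * cnj (U j k)) = (if i = j then 1 else 0)"
    and X: "\<And>i. i < n \<Longrightarrow> X i \<in> carrier_mat d r" and Z: "\<And>i. i < n \<Longrightarrow> Z i \<in> carrier_mat r d"
    and ZX: "\<And>i. i < n \<Longrightarrow> Z i * X i = 1\<^sub>m r"
    and orth: "\<And>i j. i < n \<Longrightarrow> j < n \<Longrightarrow> (\<Sum>k<n. of_real (l k) * (U i k * cnj (U j k))) \<noteq> 0
      \<Longrightarrow> mat_adjoint (X i) * X j = 0\<^sub>m r r"
    and K: "K \<subseteq> {..<n}" and sgn: "\<And>k. k \<in> K \<Longrightarrow> 0 < s * l k"
  shows "r * n \<le> d * (n - card K)"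
proof (rule ccontr)
  assume neg: "\<not> r * n \<le> d * (n - card K)"
  have finK: "finite K" using K finite_subset by blast
  define I where "I = ({..<n} - K) \<times> {..<d}"
  define J where "J = {..<n} \<times> {..<r}"
  have "card I < card J"
    using neg K finK by (simp add: I_def J_def card_cartesian_product card_Diff_subset mult.commute)
  moreover have "finite I" "finite J" by (auto simp: I_def J_def)
  ultimately obtain y where nz: "\<exists>j\<in>J. y j \<noteq> 0"
    and sol: "\<And>k a. (k, a) \<in> I \<Longrightarrow> (\<Sum>(i, p)\<in>J. cnj (U i k) * X i $$ (a, p) * y (i, p)) = 0"
    using underdetermined_system[of I J "\<lambda>(k, a) (i, p). cnj (U i k) * X i $$ (a, p)"]
    by (fastforce simp: case_prod_unfold)
  define yv where "yv i = vec r (\<lambda>p. y (i, p))" for i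
  have yv: "yv i \<in> carrier_vec r" for i by (simp add: yv_def)
  define x where "x i a = (X i *\<^sub>v yv i) $ a" for i a
  define z where "z k a = (\<Sum>i<n. cnj (U i k) * x i a)" for k a
  have zero_off: "z k a = 0" if "k < n" "k \<notin> K" "a < d" for k a
  proof -
    have "z k a = (\<Sum>i<n. \<Sum>p<r. cnj (U i k) * X i $$ (a, p) * y (i, p))"
      unfolding z_def
    proof (intro sum.cong refl)
      fix i assume "i \<in> {..<n}"
      then have "x i a = (\<Sum>p<r. X i $$ (a, p) * y (i, p))"
        using X[of i] that by (auto simp: x_def yv_def scalar_prod_def atLeast0LessThan intro!: sum.cong)
      then show "cnj (U i k) * x i a = (\<Sum>p<r. cnj (U i k) * X i $$ (a, p) * y (i, p))"
        by (simp add: sum_distrib_left mult.assoc)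
    qed
    also have "\<dots> = 0" using sol[of k a] that by (simp add: I_def J_def sum.cartesian_product)
    finally show ?thesis .
  qed
  \<comment> \<open>Completeness of the eigenbasis recovers \<open>x\<close> from its coordinates.\<close>
  have recon: "x i a = (\<Sum>k<n. U i k * z k a)" if "i < n" for i a
  proof -
    have "(\<Sum>k<n. U i k * z k a) = (\<Sum>j<n. \<Sum>k<n. U i k * cnj (U j k) * x j a)"
      unfolding z_def sum_distrib_left by (subst sum.swap) (simp add: mult.assoc)
    also have "\<dots> = (\<Sum>j<n. (if i = j then x j a else 0))"
      unfolding sum_distrib_right[symmetric] using that by (intro sum.cong) (auto simp: complete)
    finally show ?thesis using that by simp
  qed
  \<comment> \<open>The form vanishes: rewrite it as a double sum over vertices.\<close>
  have "(\<Sum>a<d. \<Sum>k<n. of_real (l k) * (z k a * cnj (z k a))) = 0"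
  proof -
    have "of_real (l k) * (z k a * cnj (z k a)) = (\<Sum>j<n. \<Sum>i<n. of_real (l k) * (U i k * cnj (U j k)) * (x j a * cnj (x i a)))" for k a
    proof -
      have "cnj (z k a) = (\<Sum>i<n. U i k * cnj (x i a))" by (simp add: z_def)
      then have "z k a * cnj (z k a) = (\<Sum>j<n. \<Sum>i<n. cnj (U j k) * x j a * (U i k * cnj (x i a)))"
        unfolding z_def by (simp only: sum_product)
      then show ?thesis by (simp add: sum_distrib_left ac_simps)
    qed
    then have "(\<Sum>a<d. \<Sum>k<n. of_real (l k) * (z k a * cnj (z k a)))
      = (\<Sum>a<d. \<Sum>k<n. \<Sum>j<n. \<Sum>i<n. of_real (l k) * (U i k * cnj (U j k)) * (x j a * cnj (x i a)))"
      by simp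
    also have "\<dots> = (\<Sum>a<d. \<Sum>j<n. \<Sum>i<n. \<Sum>k<n. of_real (l k) * (U i k * cnj (U j k)) * (x j a * cnj (x i a)))"
      by (rule sum.cong[OF refl], subst sum.swap, rule sum.cong[OF refl], rule sum.swap)
    also have "\<dots> = (\<Sum>a<d. \<Sum>j<n. \<Sum>i<n. (\<Sum>k<n. of_real (l k) * (U i k * cnj (U j k))) * (x j a * cnj (x i a)))"
      by (simp only: sum_distrib_right)
    also have "\<dots> = (\<Sum>j<n. \<Sum>i<n. \<Sum>a<d. (\<Sum>k<n. of_real (l k) * (U i k * cnj (U j k))) * (x j a * cnj (x i a)))"
      by (subst sum.swap, rule sum.cong[OF refl], rule sum.swap)
    also have "\<dots> = 0"
    proof (rule sum.neutral, rule ballI, rule sum.neutral, rule ballI)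
      fix j i assume "j \<in> {..<n}" "i \<in> {..<n}"
      then have ij: "j < n" "i < n" by auto
      have "(\<Sum>a<d. x j a * cnj (x i a)) = 0"
        if "(\<Sum>k<n. of_real (l k) * (U i k * cnj (U j k))) \<noteq> 0"
        unfolding x_def by (rule orthogonal_range_inner[OF X X orth yv yv]) (use ij that in auto)
      then show "(\<Sum>a<d. (\<Sum>k<n. of_real (l k) * (U i k * cnj (U j k))) * (x j a * cnj (x i a))) = 0"
        unfolding sum_distrib_left[symmetric] by auto
    qed
    finally show ?thesis .
  qed
  also have "(\<Sum>a<d. \<Sum>k<n. of_real (l k) * (z k a * cnj (z k a)))
      = of_real (\<Sum>a<d. \<Sum>k<n. l k * (cmod (z k a))\<^sup>2)"
    unfolding of_real_sum by (intro sum.cong refl) (simp only: of_real_mult complex_norm_square)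
  finally have "(\<Sum>a<d. \<Sum>k<n. l k * (cmod (z k a))\<^sup>2) = 0" using of_real_eq_0_iff by blast
  then have "(\<Sum>a<d. \<Sum>k<n. s * l k * (cmod (z k a))\<^sup>2) = 0"
    by (simp add: mult.assoc flip: sum_distrib_left)
  moreover have nn: "0 \<le> s * l k * (cmod (z k a))\<^sup>2" if "a < d" "k < n" for a k
    using zero_off[of k a] sgn[of k] that by (cases "k \<in> K") auto
  ultimately have "\<forall>a\<in>{..<d}. (\<Sum>k<n. s * l k * (cmod (z k a))\<^sup>2) = 0"
    by (subst (asm) sum_nonneg_eq_0_iff) (auto intro!: sum_nonneg)
  then have "\<forall>k\<in>{..<n}. s * l k * (cmod (z k a))\<^sup>2 = 0" if "a < d" for a
    using that nn by (subst sum_nonneg_eq_0_iff[symmetric]) auto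
  then have all0: "s * l k * (cmod (z k a))\<^sup>2 = 0" if "a < d" "k < n" for a k
    using that by blast
  have z0: "z k a = 0" if "a < d" "k < n" for a k
    using all0[OF that] zero_off[of k a] sgn[of k] that by (cases "k \<in> K") auto
  have "y (i, p) = 0" if ip: "i < n" "p < r" for i p
  proof -
    have "X i *\<^sub>v yv i = 0\<^sub>v d"
    proof (rule eq_vecI)
      fix a assume "a < dim_vec (0\<^sub>v d :: complex vec)"
      then show "(X i *\<^sub>v yv i) $ a = 0\<^sub>v d $ a" using recon[of i a] z0 ip unfolding x_def by simp
    qed (use X[OF ip(1)] in simp)
    then have "Z i *\<^sub>v (X i *\<^sub>v yv i) = 0\<^sub>v r" using Z[OF ip(1)] by (auto intro!: eq_vecI)
    then have "yv i = 0\<^sub>v r"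
      using ZX[OF ip(1)] yv by (simp add: assoc_mult_mat_vec[OF Z[OF ip(1)] X[OF ip(1)] yv, symmetric])
    then have "yv i $ p = 0" using ip by simp
    then show ?thesis using ip by (simp add: yv_def)
  qed
  then show False using nz by (auto simp: J_def)
qed

section \<open>The inertia bound\<close>

text \<open>
  The product of the ranges of the projectors is isotropic for the adjacency matrix: across
  an edge, \<open>X\<^sub>i\<^sup>* X\<^sub>j = X\<^sub>i\<^sup>* P\<^sub>i P\<^sub>j X\<^sub>j = 0\<close>, as \<open>P\<^sub>i\<close> is Hermitian and fixes the columns of \<open>X\<^sub>i\<close>.
\<close>

lemma representation_dimension_bound:
  fixes G :: "'v pair_pre_digraph" and U :: "complex mat"
  assumes vs: "set vs = pverts G" and n: "length vs = n"
    and U: "U \<in> carrier_mat n n" "mat_adjoint U * U = 1\<^sub>m n"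
    and A: "map_mat complex_of_real (adjacency_matrix G vs) = U * real_diag n l * mat_adjoint U"
    and rep: "is_representation G d r P"
    and K: "K \<subseteq> {..<n}" and sgn: "\<And>k. k \<in> K \<Longrightarrow> 0 < s * l k"
  shows "r * n \<le> d * (n - card K)"
proof -
  note U' = mat_adjoint_carrier[OF U(1)]
  have complete: "(\<Sum>k<n. U $$ (i, k) * cnj (U $$ (j, k))) = (if i = j then 1 else 0)"
    if "i < n" "j < n" for i j
  proof -
    have "(\<Sum>k<n. U $$ (i, k) * cnj (U $$ (j, k))) = (U * mat_adjoint U) $$ (i, j)"
      using U(1) that by (auto simp: scalar_prod_def atLeast0LessThan intro!: sum.cong)
    then show ?thesis using mat_mult_left_right_inverse[OF U' U] that by simp
  qed
  have entry: "(if (vs ! i, vs ! j) \<in> parcs G then 1 else 0)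
      = (\<Sum>k<n. of_real (l k) * (U $$ (i, k) * cnj (U $$ (j, k))))" if ij: "i < n" "j < n" for i j
  proof -
    have UD: "(U * real_diag n l) $$ (i, k) = of_real (l k) * U $$ (i, k)" if "k < n" for k
    proof -
      have "(U * real_diag n l) $$ (i, k) = (\<Sum>q\<in>{0..<n}. U $$ (i, q) * (if q = k then of_real (l q) else 0))"
        using U(1) ij that by (auto simp: scalar_prod_def real_diag_def intro!: sum.cong)
      also have "\<dots> = (\<Sum>q\<in>{0..<n}. if q = k then of_real (l k) * U $$ (i, k) else 0)"
        by (intro sum.cong) auto
      finally show ?thesis using that by simp
    qed
    have "(if (vs ! i, vs ! j) \<in> parcs G then 1 else 0)
        = map_mat complex_of_real (adjacency_matrix G vs) $$ (i, j)"
      using ij n by (simp add: adjacency_matrix_def)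
    also have "\<dots> = (\<Sum>k\<in>{0..<n}. (U * real_diag n l) $$ (i, k) * mat_adjoint U $$ (k, j))"
      unfolding A using U(1) U' ij carrier_matD[OF real_diag_carrier, of n l]
      by (auto simp: scalar_prod_def intro!: sum.cong)
    also have "\<dots> = (\<Sum>k<n. of_real (l k) * (U $$ (i, k) * cnj (U $$ (j, k))))"
      unfolding atLeast0LessThan using U(1) ij by (intro sum.cong) (auto simp: UD)
    finally show ?thesis .
  qed
  have proj: "orthogonal_projector d (P (vs ! i))" "vec_space.rank d (P (vs ! i)) = r" if "i < n" for i
    using rep vs n that nth_mem[of i vs] by (auto simp: is_representation_def)
  have "\<forall>i\<in>{..<n}. \<exists>X Z. X \<in> carrier_mat d r \<and> Z \<in> carrier_mat r d
      \<and> P (vs ! i) = X * Z \<and> Z * X = 1\<^sub>m r"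
  proof
    fix i assume "i \<in> {..<n}"
    then have "i < n" by simp
    then show "\<exists>X Z. X \<in> carrier_mat d r \<and> Z \<in> carrier_mat r d \<and> P (vs ! i) = X * Z \<and> Z * X = 1\<^sub>m r"
      using idempotent_factorization[of "P (vs ! i)" d r] proj[of i]
      by (simp add: orthogonal_projector_def)
  qed
  then obtain X Z where XZ: "\<And>i. i < n \<Longrightarrow> X i \<in> carrier_mat d r \<and> Z i \<in> carrier_mat r d
      \<and> P (vs ! i) = X i * Z i \<and> Z i * X i = 1\<^sub>m r"
    unfolding lessThan_iff Ball_def by metis
  have orth: "mat_adjoint (X i) * X j = 0\<^sub>m r r" if ij: "i < n" "j < n" and e: "(vs ! i, vs ! j) \<in> parcs G" for i j
  proof -
    have PX: "P (vs ! k) * X k = X k" if "k < n" for k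
      using XZ[OF that] by (metis assoc_mult_mat right_mult_one_mat)
    have Xi: "X i \<in> carrier_mat d r" and Xj: "X j \<in> carrier_mat d r" using XZ ij by auto
    have Pi: "P (vs ! i) \<in> carrier_mat d d" "mat_adjoint (P (vs ! i)) = P (vs ! i)"
      and Pj: "P (vs ! j) \<in> carrier_mat d d"
      using proj ij by (auto simp: orthogonal_projector_def)
    note Xi' = mat_adjoint_carrier[OF Xi]
    have "mat_adjoint (X i) * X j = mat_adjoint (P (vs ! i) * X i) * (P (vs ! j) * X j)"
      using PX ij by simp
    also have "\<dots> = (mat_adjoint (X i) * P (vs ! i)) * (P (vs ! j) * X j)"
      by (simp only: mat_adjoint_mult[OF Pi(1) Xi] Pi(2))
    also have "\<dots> = mat_adjoint (X i) * ((P (vs ! i) * P (vs ! j)) * X j)"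
      by (simp only: assoc_mult_mat[OF Xi' Pi(1) mult_carrier_mat[OF Pj Xj]] assoc_mult_mat[OF Pi(1) Pj Xj])
    also have "P (vs ! i) * P (vs ! j) = 0\<^sub>m d d" using rep e by (auto simp: is_representation_def)
    finally show ?thesis using left_mult_zero_mat[OF Xj] right_mult_zero_mat[OF Xi'] by simp
  qed
  show ?thesis
  proof (rule isotropic_dimension_bound[where U = "\<lambda>i k. U $$ (i, k)" and X = X and Z = Z and l = l and s = s])
    fix i j assume ij: "i < n" "j < n"
      and "(\<Sum>k<n. complex_of_real (l k) * (U $$ (i, k) * cnj (U $$ (j, k)))) \<noteq> 0"
    then have "(vs ! i, vs ! j) \<in> parcs G" using entry[OF ij] by (metis (full_types))
    then show "mat_adjoint (X i) * X j = 0\<^sub>m r r" by (rule orth[OF ij])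
  qed (use complete XZ K sgn in auto)
qed

text \<open>
  A bound on all representations bounds every quotient in the limit. Positivity of \<open>m\<close> is part of the
  conclusion, as it shows that no denominator in the final estimate is zero: an adjacency matrix is
  neither positive nor negative definite.
\<close>

lemma ratio_le_projective_rank:
  assumes G: "pair_graph G" "pverts G \<noteq> {}" and n: "0 < n"
    and bound: "\<And>d r P. is_representation G d r P \<Longrightarrow> r * n \<le> d * m"
  shows "0 < m" and "real n / real m \<le> projective_rank G"
proof -
  have le: "r * n \<le> orthogonal_rank r G * m" if "0 < r" for r
    using orthogonal_rank_attained(2)[OF G that] bound by blast
  show m: "0 < m" using le[of 1] n by (cases m) auto
  have "real n / real m \<le> real (orthogonal_rank r G) / real r" if "1 \<le> r" for r
  proof -
    have "real (r * n) \<le> real (orthogonal_rank r G * m)" using le[of r] that by (simp only: of_nat_le_iff)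
    then show ?thesis using m that by (simp add: field_simps)
  qed
  then show "real n / real m \<le> projective_rank G"
    by (intro LIMSEQ_le_const[OF projective_rank_limit[OF G]]) blast
qed

theorem theorem3:
  fixes G :: "'v pair_pre_digraph"
    and vs :: "'v list"
    and n_pos n_zero n_neg :: nat
  assumes "pair_graph G"
    and "pverts G \<noteq> {}"
    and "distinct vs" and "set vs = pverts G"
    and "inertia (adjacency_matrix G vs) = (n_pos, n_zero, n_neg)"
  shows "1 + max (real n_pos / real (n_neg + n_zero)) (real n_neg / real (n_pos + n_zero))
           \<le> projective_rank G"
proof -
  interpret pair_graph G by fact
  define A where "A = adjacency_matrix G vs"
  define n where "n = length vs"
  have n0: "0 < n" using assms(2,4) by (auto simp: n_def)
  have A: "A \<in> carrier_mat n n" by (simp add: A_def n_def adjacency_matrix_def)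
  have "(vs ! i, vs ! j) \<in> parcs G \<longleftrightarrow> (vs ! j, vs ! i) \<in> parcs G" for i j
    using pair_sym_arcs by (auto simp: symmetric_def sym_def)
  then have "mat_adjoint (map_mat complex_of_real A) = map_mat complex_of_real A"
    by (intro eq_matI) (auto simp: A_def adjacency_matrix_def)
  then obtain U l where U: "U \<in> carrier_mat n n" "mat_adjoint U * U = 1\<^sub>m n"
    and AU: "map_mat complex_of_real A = U * real_diag n l * mat_adjoint U"
    using hermitian_unitarily_diagonalizable[of "map_mat complex_of_real A" n] A by auto
  define K where "K Q = {k. k < n \<and> Q (l k)}" for Q :: "real \<Rightarrow> bool"
  have count: "count_eigenvalues Q A = card (K Q)" for Q
    unfolding K_def by (rule count_eigenvalues_eq_card[OF A char_poly_real_diagonalized[OF A U AU]])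
  have pos: "n_pos = card (K (\<lambda>x. 0 < x))" and zero: "n_zero = card (K (\<lambda>x. x = 0))"
    and neg: "n_neg = card (K (\<lambda>x. x < 0))"
    using assms(5) by (auto simp: inertia_def count A_def[symmetric])
  \<comment> \<open>The three counts exhaust the diagonal, so the inertia sums to \<open>n\<close>.\<close>
  have KU: "{..<n} = K (\<lambda>x. 0 < x) \<union> (K (\<lambda>x. x = 0) \<union> K (\<lambda>x. x < 0))"
    by (auto simp: K_def)
  have "card {..<n} = n_pos + (n_zero + n_neg)"
    unfolding pos zero neg KU by (subst card_Un_disjoint; (subst card_Un_disjoint)?) (auto simp: K_def)
  then have total: "n = n_pos + n_zero + n_neg" by simp
  have bound: "r * n \<le> d * (n - card (K Q))"
    if "is_representation G d r P" "\<And>x. Q x \<Longrightarrow> 0 < s * x" for d r P Q and s :: real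
    by (rule representation_dimension_bound[OF assms(4) n_def[symmetric] U AU[unfolded A_def] that(1)])
      (use that(2) in \<open>auto simp: K_def\<close>)
  have minus_pos: "n - n_pos = n_neg + n_zero" and minus_neg: "n - n_neg = n_pos + n_zero"
    using total by auto
  have pos_bound: "r * n \<le> d * (n_neg + n_zero)" if "is_representation G d r P" for d r P
    using bound[OF that, of "\<lambda>x. 0 < x" 1] by (simp flip: pos minus_pos)
  have neg_bound: "r * n \<le> d * (n_pos + n_zero)" if "is_representation G d r P" for d r P
    using bound[OF that, of "\<lambda>x. x < 0" "-1"] by (simp flip: neg minus_neg)
  note pos_ratio = ratio_le_projective_rank[OF assms(1,2) n0 pos_bound]
  note neg_ratio = ratio_le_projective_rank[OF assms(1,2) n0 neg_bound]
  have "1 + real n_pos / real (n_neg + n_zero) = real n / real (n_neg + n_zero)"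
  proof -
    have "real n = real (n_neg + n_zero) + real n_pos" using total by simp
    then show ?thesis using pos_ratio(1) by (simp add: add_divide_distrib del: of_nat_add)
  qed
  moreover have "1 + real n_neg / real (n_pos + n_zero) = real n / real (n_pos + n_zero)"
  proof -
    have "real n = real (n_pos + n_zero) + real n_neg" using total by simp
    then show ?thesis using neg_ratio(1) by (simp add: add_divide_distrib del: of_nat_add)
  qed
  ultimately show ?thesis using pos_ratio(2) neg_ratio(2) by (simp add: max_def)
qed

end
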